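(* Let $R$ be a unital associative ring in which $2$ is invertible, and suppose that $R$ is generated by two of its elements. Let $\Delta:R\to R$ be a derivation on $R$. If $\Delta$ is a 2-local inner derivation, then $\Delta$ is an inner derivation.
   Context: A derivation on an associative ring $R$ is a map $D:R\to R$ with $D(x+y)=D(x)+D(y)$ and $D(xy)=D(x)y+xD(y)$ for all $x,y\in R$. It is inner if there is $a\in R$ with $D(x)=ax-xa$ for all $x\in R$. A map $\Delta:R\to R$ is a 2-local inner derivation if for any two elements $x,y\in R$ there exists $a\in R$ (depending on $x,y$) such that $\Delta(x)=ax-xa$ and $\Delta(y)=ay-ya$. "$R$ is generated by two elements $x,y\in R$" means that the smallest additive subgroup of $R$ that contains $x$ and $y$ and is closed under multiplication is $R$ itself. *)

theory Defs
  imports "HOL-Algebra.Ring" "HOL-Algebra.AbelCoset"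
begin

definition ring_derivation :: "('a, 'b) ring_scheme \<Rightarrow> ('a \<Rightarrow> 'a) \<Rightarrow> bool" where
  "ring_derivation R D \<longleftrightarrow>
     D \<in> carrier R \<rightarrow> carrier R \<and>
     (\<forall>x\<in>carrier R. \<forall>y\<in>carrier R. D (x \<oplus>\<^bsub>R\<^esub> y) = D x \<oplus>\<^bsub>R\<^esub> D y) \<and>
     (\<forall>x\<in>carrier R. \<forall>y\<in>carrier R.
        D (x \<otimes>\<^bsub>R\<^esub> y) = (D x \<otimes>\<^bsub>R\<^esub> y) \<oplus>\<^bsub>R\<^esub> (x \<otimes>\<^bsub>R\<^esub> D y))"

definition inner_derivation :: "('a, 'b) ring_scheme \<Rightarrow> ('a \<Rightarrow> 'a) \<Rightarrow> bool" where
  "inner_derivation R D \<longleftrightarrow>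
     ring_derivation R D \<and>
     (\<exists>a\<in>carrier R. \<forall>x\<in>carrier R. D x = (a \<otimes>\<^bsub>R\<^esub> x) \<ominus>\<^bsub>R\<^esub> (x \<otimes>\<^bsub>R\<^esub> a))"

definition two_local_inner_derivation :: "('a, 'b) ring_scheme \<Rightarrow> ('a \<Rightarrow> 'a) \<Rightarrow> bool" where
  "two_local_inner_derivation R D \<longleftrightarrow>
     D \<in> carrier R \<rightarrow> carrier R \<and>
     (\<forall>x\<in>carrier R. \<forall>y\<in>carrier R. \<exists>a\<in>carrier R.
        D x = (a \<otimes>\<^bsub>R\<^esub> x) \<ominus>\<^bsub>R\<^esub> (x \<otimes>\<^bsub>R\<^esub> a) \<and>
        D y = (a \<otimes>\<^bsub>R\<^esub> y) \<ominus>\<^bsub>R\<^esub> (y \<otimes>\<^bsub>R\<^esub> a))"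

text \<open>Unlike \<open>generate_ring\<close> of HOL-Algebra, the generated subring below need not contain
  \<open>\<one>\<close>: it is the smallest additive subgroup that contains the given set and is closed
  under multiplication.\<close>

definition generated_nonunital_subring :: "('a, 'b) ring_scheme \<Rightarrow> 'a set \<Rightarrow> 'a set" where
  "generated_nonunital_subring R S =
     \<Inter>{H. additive_subgroup H R \<and> (\<forall>a\<in>H. \<forall>b\<in>H. a \<otimes>\<^bsub>R\<^esub> b \<in> H) \<and> S \<subseteq> H}"

end

theory Submission imports Defs begin

text \<open>Apply 2-locality just once, to the pair of generators: it yields a single
  \<open>a\<close> for which \<open>\<Delta>\<close> and the commutator map of \<open>a\<close>
  agree at both. That map is itself a derivation (\<open>ring_derivation_commutator\<close>), and
  two derivations that agree on a set agree on everything it generates without a unit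
  (\<open>ring_derivation_eqI\<close>). As the generators give the whole ring,
  \<open>\<Delta>\<close> is the commutator map of \<open>a\<close>.\<close>

context ring
begin

text \<open>The Leibniz rule is a telescoping sum: insert - xay + xay between axy and - xya.\<close>

lemma ring_derivation_commutator:
  assumes a: "a \<in> carrier R"
  shows "ring_derivation R (\<lambda>x. a \<otimes> x \<ominus> x \<otimes> a)"
proof -
  have "a \<otimes> (x \<oplus> y) \<ominus> (x \<oplus> y) \<otimes> a = (a \<otimes> x \<ominus> x \<otimes> a) \<oplus> (a \<otimes> y \<ominus> y \<otimes> a)"
    "a \<otimes> (x \<otimes> y) \<ominus> (x \<otimes> y) \<otimes> a =
      (a \<otimes> x \<ominus> x \<otimes> a) \<otimes> y \<oplus> x \<otimes> (a \<otimes> y \<ominus> y \<otimes> a)"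
    if "x \<in> carrier R" "y \<in> carrier R" for x y
    using a that by algebra+
  then show ?thesis
    unfolding ring_derivation_def using a by auto
qed

text \<open>Lets the facts that homomorphisms preserve zero and negatives be used for
  derivations.\<close>

lemma ring_derivation_abelian_group_hom:
  assumes "ring_derivation R D"
  shows "abelian_group_hom R R D"
proof -
  have "D \<in> hom (add_monoid R) (add_monoid R)"
    using assms by (simp add: ring_derivation_def hom_def)
  then show ?thesis
    by unfold_locales
qed

text \<open>The equalizer \<open>H\<close> of two derivations is an additive subgroup closed under
  multiplication, hence one of the sets whose intersection is the generated subring.\<close>

lemma ring_derivation_eqI:
  assumes D: "ring_derivation R D" and E: "ring_derivation R E"
    and S: "S \<subseteq> carrier R" and eq: "\<And>s. s \<in> S \<Longrightarrow> D s = E s"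
    and gen: "z \<in> generated_nonunital_subring R S"
  shows "D z = E z"
proof -
  define H where "H = {z \<in> carrier R. D z = E z}"
  \<comment> \<open>By Leibniz, the value at a product is determined by the factors and the values
    there.\<close>
  have mult: "u \<otimes> v \<in> H" if "u \<in> H" "v \<in> H" for u v
    using that D E by (simp add: H_def ring_derivation_def)
  have "S \<subseteq> H"
    using S eq by (auto simp: H_def)
  interpret D: abelian_group_hom R R D
    using D by (rule ring_derivation_abelian_group_hom)
  interpret E: abelian_group_hom R R E
    using E by (rule ring_derivation_abelian_group_hom)
  have "\<zero> \<in> H"
    by (simp add: H_def)
  moreover have "u \<oplus> v \<in> H" if "u \<in> H" "v \<in> H" for u v
    using that by (simp add: H_def)
  moreover have "\<ominus> u \<in> H" if "u \<in> H" for u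
    using that by (simp add: H_def)
  ultimately have "subgroup H (add_monoid R)"
    by (intro add.subgroupI) (auto simp: H_def a_inv_def)
  then have "additive_subgroup H R"
    by (rule additive_subgroup.intro)
  with mult \<open>S \<subseteq> H\<close> gen have "z \<in> H"
    unfolding generated_nonunital_subring_def by blast
  then show ?thesis
    by (simp add: H_def)
qed

end

theorem theorem3p5:
  fixes R :: "('a, 'b) ring_scheme" and \<Delta> :: "'a \<Rightarrow> 'a"
  assumes "ring R"
    and "\<one>\<^bsub>R\<^esub> \<oplus>\<^bsub>R\<^esub> \<one>\<^bsub>R\<^esub> \<in> Units R"
    and "\<exists>x\<in>carrier R. \<exists>y\<in>carrier R. generated_nonunital_subring R {x, y} = carrier R"
    and "ring_derivation R \<Delta>"
    and "two_local_inner_derivation R \<Delta>"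
  shows "inner_derivation R \<Delta>"
proof -
  interpret ring R by fact
  obtain x y where xy: "x \<in> carrier R" "y \<in> carrier R"
    and gen: "generated_nonunital_subring R {x, y} = carrier R"
    using assms(3) by blast
  \<comment> \<open>The same \<open>a\<close> serves both generators; choosing one for each
    separately would not suffice.\<close>
  obtain a where a: "a \<in> carrier R"
    and eq: "\<Delta> x = a \<otimes>\<^bsub>R\<^esub> x \<ominus>\<^bsub>R\<^esub> x \<otimes>\<^bsub>R\<^esub> a" "\<Delta> y = a \<otimes>\<^bsub>R\<^esub> y \<ominus>\<^bsub>R\<^esub> y \<otimes>\<^bsub>R\<^esub> a"
    using assms(5) xy unfolding two_local_inner_derivation_def by blast
  have "\<Delta> z = a \<otimes>\<^bsub>R\<^esub> z \<ominus>\<^bsub>R\<^esub> z \<otimes>\<^bsub>R\<^esub> a" if "z \<in> carrier R" for z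
    using ring_derivation_eqI[OF assms(4) ring_derivation_commutator[OF a], of "{x, y}" z]
      xy eq gen that by auto
  then show ?thesis
    using assms(4) a unfolding inner_derivation_def by blast
qed

end
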